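(* Let $i\in\mathbb{Z}$, let $(R,\mathfrak{m})$ be a local ring, $\mathfrak{a}$ an ideal of $R$, and $M$ a finitely generated $R$-module. Assume that $\mathfrak{F}^i_{\mathfrak{a}}(M)$ is an Artinian $R$-module. Then $\operatorname{CoSupp}\mathfrak{F}^i_{\mathfrak{a}}(M)\subseteq V(\mathfrak{a})$.
   Context: All rings are commutative and Noetherian. $V(\mathfrak{a})$ is the set of prime ideals of $R$ containing $\mathfrak{a}$. For a local ring $(R,\mathfrak{m})$, an ideal $\mathfrak{a}$, an $R$-module $M$ and $i\in\mathbb{Z}$, the $i$-th formal local cohomology module of $M$ with respect to $\mathfrak{a}$ is $\mathfrak{F}^i_{\mathfrak{a}}(M):=\varprojlim_n H^i_{\mathfrak{m}}(M/\mathfrak{a}^nM)$, where $H^i_{\mathfrak{m}}$ denotes local cohomology and the transition maps are induced by the natural maps $M/\mathfrak{a}^{n+1}M\to M/\mathfrak{a}^nM$. Colocalization and cosupport (in the sense of Richardson): for a ring $R$ let $E_R$ be the injective hull of $\bigoplus R/\mathfrak{n}$, the sum running over all maximal ideals $\mathfrak{n}$ of $R$, and $D_R(-):=\operatorname{Hom}_R(-,E_R)$. For a prime ideal $\mathfrak{p}$ of $R$ and an $R$-module $N$, ${}^{\mathfrak{p}}N:=D_{R_{\mathfrak{p}}}(D_R(N)_{\mathfrak{p}})$, and $\operatorname{CoSupp}(N):=\{\mathfrak{p}\in\operatorname{Spec}(R) : {}^{\mathfrak{p}}N\neq 0\}$. *)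

theory Defs
  imports "HOL-Algebra.Module" "HOL-Algebra.Ideal_Product" "HOL-Algebra.Ring_Divisibility"
begin

text \<open>
  The fields \<open>mult\<close> and \<open>one\<close> of a record of type \<open>('a, 'm) module\<close> play no role for modules; in
  the modules constructed below they are \<open>undefined\<close>.
\<close>

section \<open>Rings and ideals\<close>

definition local_ring :: "('a, 'r) ring_scheme \<Rightarrow> 'a set \<Rightarrow> bool" where
  "local_ring R m \<longleftrightarrow> cring R \<and> {n. maximalideal n R} = {m}"

definition Spec :: "('a, 'r) ring_scheme \<Rightarrow> 'a set set" where
  "Spec R = {p. primeideal p R}"

definition V :: "('a, 'r) ring_scheme \<Rightarrow> 'a set \<Rightarrow> 'a set set" where
  "V R a = {p \<in> Spec R. a \<subseteq> p}"

primrec ideal_power :: "('a, 'r) ring_scheme \<Rightarrow> 'a set \<Rightarrow> nat \<Rightarrow> 'a set" where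
  "ideal_power R a 0 = carrier R"
| "ideal_power R a (Suc n) = ideal_prod R a (ideal_power R a n)"


section \<open>Modules\<close>

definition module_span :: "('a, 'r) ring_scheme \<Rightarrow> ('a, 'm) module \<Rightarrow> 'm set \<Rightarrow> 'm set" where
  "module_span R M S = \<Inter>{N. submodule N R M \<and> S \<subseteq> N}"

definition finitely_generated :: "('a, 'r) ring_scheme \<Rightarrow> ('a, 'm) module \<Rightarrow> bool" where
  "finitely_generated R M \<longleftrightarrow>
     (\<exists>S \<subseteq> carrier M. finite S \<and> module_span R M S = carrier M)"

definition artinian_module :: "('a, 'r) ring_scheme \<Rightarrow> ('a, 'm) module \<Rightarrow> bool" where
  "artinian_module R M \<longleftrightarrow>
     (\<forall>N :: nat \<Rightarrow> 'm set. (\<forall>n. submodule (N n) R M) \<and> (\<forall>n. N (Suc n) \<subseteq> N n)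
        \<longrightarrow> (\<exists>k. \<forall>n\<ge>k. N n = N k))"

definition ideal_smult ::
    "('a, 'r) ring_scheme \<Rightarrow> 'a set \<Rightarrow> ('a, 'm) module \<Rightarrow> 'm set" where
  "ideal_smult R a M = module_span R M {r \<odot>\<^bsub>M\<^esub> x |r x. r \<in> a \<and> x \<in> carrier M}"

definition regular_module :: "('a, 'r) ring_scheme \<Rightarrow> ('a, 'a) module" where
  "regular_module R =
     \<lparr>carrier = carrier R, monoid.mult = undefined, one = undefined,
      ring.zero = \<zero>\<^bsub>R\<^esub>, add = (\<oplus>\<^bsub>R\<^esub>), smult = (\<otimes>\<^bsub>R\<^esub>)\<rparr>"

definition quot_module :: "('a, 'm) module \<Rightarrow> 'm set \<Rightarrow> ('a, 'm set) module" where
  "quot_module M N =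
     \<lparr>carrier = a_rcosets\<^bsub>M\<^esub> N, monoid.mult = undefined, one = undefined,
      ring.zero = N, add = set_add M,
      smult = (\<lambda>r X. \<Union>x\<in>X. N +>\<^bsub>M\<^esub> (r \<odot>\<^bsub>M\<^esub> x))\<rparr>"

text \<open>The map \<open>M'/N' \<rightarrow> M/N\<close> induced by \<open>f : M' \<rightarrow> M\<close> with \<open>f(N') \<subseteq> N\<close>.\<close>

definition quot_map :: "('a, 'm) module \<Rightarrow> 'm set \<Rightarrow> ('l \<Rightarrow> 'm) \<Rightarrow> 'l set \<Rightarrow> 'm set" where
  "quot_map M N f X = (\<Union>x\<in>X. N +>\<^bsub>M\<^esub> f x)"

definition module_hom ::
    "('a, 'r) ring_scheme \<Rightarrow> ('a, 'm) module \<Rightarrow> ('a, 'n) module \<Rightarrow> ('m \<Rightarrow> 'n) set" where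
  "module_hom R M N =
     {f \<in> carrier M \<rightarrow> carrier N.
        (\<forall>x\<in>carrier M. \<forall>y\<in>carrier M. f (x \<oplus>\<^bsub>M\<^esub> y) = f x \<oplus>\<^bsub>N\<^esub> f y) \<and>
        (\<forall>r\<in>carrier R. \<forall>x\<in>carrier M. f (r \<odot>\<^bsub>M\<^esub> x) = r \<odot>\<^bsub>N\<^esub> f x)}"

definition hom_module ::
    "('a, 'r) ring_scheme \<Rightarrow> ('a, 'm) module \<Rightarrow> ('a, 'n) module \<Rightarrow> ('a, 'm \<Rightarrow> 'n) module" where
  "hom_module R M N =
     \<lparr>carrier = module_hom R M N \<inter> extensional (carrier M), monoid.mult = undefined, one = undefined,
      ring.zero = (\<lambda>x\<in>carrier M. \<zero>\<^bsub>N\<^esub>),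
      add = (\<lambda>f g. \<lambda>x\<in>carrier M. f x \<oplus>\<^bsub>N\<^esub> g x),
      smult = (\<lambda>r f. \<lambda>x\<in>carrier M. r \<odot>\<^bsub>N\<^esub> f x)\<rparr>"

definition direct_sum :: "'i set \<Rightarrow> ('i \<Rightarrow> ('a, 'm) module) \<Rightarrow> ('a, 'i \<Rightarrow> 'm) module" where
  "direct_sum I M =
     \<lparr>carrier = {f \<in> (\<Pi>\<^sub>E i\<in>I. carrier (M i)). finite {i \<in> I. f i \<noteq> \<zero>\<^bsub>M i\<^esub>}},
      monoid.mult = undefined, one = undefined,
      ring.zero = (\<lambda>i\<in>I. \<zero>\<^bsub>M i\<^esub>),
      add = (\<lambda>f g. \<lambda>i\<in>I. f i \<oplus>\<^bsub>M i\<^esub> g i),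
      smult = (\<lambda>r f. \<lambda>i\<in>I. r \<odot>\<^bsub>M i\<^esub> f i)\<rparr>"

text \<open>Inverse limit of a tower \<open>\<dots> \<rightarrow> H 2 \<rightarrow> H 1 \<rightarrow> H 0\<close> with transition maps
  \<open>t n : H (n + 1) \<rightarrow> H n\<close>.\<close>

definition inverse_limit ::
    "(nat \<Rightarrow> ('a, 'm) module) \<Rightarrow> (nat \<Rightarrow> 'm \<Rightarrow> 'm) \<Rightarrow> ('a, nat \<Rightarrow> 'm) module" where
  "inverse_limit H t =
     \<lparr>carrier = {x. \<forall>n. x n \<in> carrier (H n) \<and> t n (x (Suc n)) = x n},
      monoid.mult = undefined, one = undefined,
      ring.zero = (\<lambda>n. \<zero>\<^bsub>H n\<^esub>),
      add = (\<lambda>x y n. x n \<oplus>\<^bsub>H n\<^esub> y n),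
      smult = (\<lambda>r x n. r \<odot>\<^bsub>H n\<^esub> x n)\<rparr>"


section \<open>Injective modules and injective hulls\<close>

text \<open>
  The extension property along monomorphisms \<open>A \<rightarrow> B\<close>. A definition cannot quantify over all types,
  so the test modules live in \<open>'a + 'e\<close>. Since this type contains a copy of every ideal of \<open>R\<close>
  and of \<open>R\<close> itself, Baer's criterion shows that no generality is lost.
\<close>

definition injective_module :: "('a, 'r) ring_scheme \<Rightarrow> ('a, 'e) module \<Rightarrow> bool" where
  "injective_module R E \<longleftrightarrow> module R E \<and>
     (\<forall>(A :: ('a, 'a + 'e) module) (B :: ('a, 'a + 'e) module) f g.
        module R A \<and> module R B \<and> f \<in> module_hom R A B \<and> inj_on f (carrier A)
          \<and> g \<in> module_hom R A E
        \<longrightarrow> (\<exists>h \<in> module_hom R B E. \<forall>x\<in>carrier A. h (f x) = g x))"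

definition injective_hull ::
    "('a, 'r) ring_scheme \<Rightarrow> ('a, 'm) module \<Rightarrow> ('a, 'e) module \<Rightarrow> bool" where
  "injective_hull R M E \<longleftrightarrow> injective_module R E \<and>
     (\<exists>f \<in> module_hom R M E. inj_on f (carrier M) \<and>
        (\<forall>N. submodule N R E \<and> N \<inter> f ` carrier M = {\<zero>\<^bsub>E\<^esub>} \<longrightarrow> N = {\<zero>\<^bsub>E\<^esub>}))"


section \<open>Local cohomology\<close>

definition torsion_part ::
    "('a, 'r) ring_scheme \<Rightarrow> 'a set \<Rightarrow> ('a, 'm) module \<Rightarrow> ('a, 'm) module" where
  "torsion_part R a M =
     M\<lparr>carrier := {x \<in> carrier M. \<exists>n. \<forall>r \<in> ideal_power R a n. r \<odot>\<^bsub>M\<^esub> x = \<zero>\<^bsub>M\<^esub>}\<rparr>"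

text \<open>Complexes are cohomologically graded, with \<open>d k : C k \<rightarrow> C (k + 1)\<close>.\<close>

definition cocycles ::
    "(int \<Rightarrow> ('a, 'm) module) \<Rightarrow> (int \<Rightarrow> 'm \<Rightarrow> 'm) \<Rightarrow> int \<Rightarrow> ('a, 'm) module" where
  "cocycles C d k = (C k)\<lparr>carrier := a_kernel (C k) (C (k + 1)) (d k)\<rparr>"

definition coboundaries ::
    "(int \<Rightarrow> ('a, 'm) module) \<Rightarrow> (int \<Rightarrow> 'm \<Rightarrow> 'm) \<Rightarrow> int \<Rightarrow> 'm set" where
  "coboundaries C d k = d (k - 1) ` carrier (C (k - 1))"

definition cohomology ::
    "(int \<Rightarrow> ('a, 'm) module) \<Rightarrow> (int \<Rightarrow> 'm \<Rightarrow> 'm) \<Rightarrow> int \<Rightarrow> ('a, 'm set) module" where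
  "cohomology C d k = quot_module (cocycles C d k) (coboundaries C d k)"

text \<open>The map \<open>H\<^sup>k(C') \<rightarrow> H\<^sup>k(C)\<close> induced by a chain map \<open>f : C' \<rightarrow> C\<close>; only the target \<open>C\<close>
  enters the formula.\<close>

definition cohomology_map ::
    "(int \<Rightarrow> ('a, 'm) module) \<Rightarrow> (int \<Rightarrow> 'm \<Rightarrow> 'm) \<Rightarrow> (int \<Rightarrow> 'l \<Rightarrow> 'm) \<Rightarrow> int
       \<Rightarrow> 'l set \<Rightarrow> 'm set" where
  "cohomology_map C d f k = quot_map (cocycles C d k) (coboundaries C d k) (f k)"

text \<open>\<open>0 \<rightarrow> M \<rightarrow> I 0 \<rightarrow> I 1 \<rightarrow> \<dots>\<close> is exact with augmentation \<open>e\<close>, and \<open>I k = 0\<close> for \<open>k < 0\<close>.\<close>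

definition injective_resolution ::
    "('a, 'r) ring_scheme \<Rightarrow> ('a, 'm) module \<Rightarrow> (int \<Rightarrow> ('a, 'e) module) \<Rightarrow> (int \<Rightarrow> 'e \<Rightarrow> 'e)
       \<Rightarrow> ('m \<Rightarrow> 'e) \<Rightarrow> bool" where
  "injective_resolution R M I d e \<longleftrightarrow>
     (\<forall>k. injective_module R (I k)) \<and>
     (\<forall>k<0. carrier (I k) = {\<zero>\<^bsub>I k\<^esub>}) \<and>
     (\<forall>k. d k \<in> module_hom R (I k) (I (k + 1))) \<and>
     e \<in> module_hom R M (I 0) \<and> inj_on e (carrier M) \<and>
     e ` carrier M = a_kernel (I 0) (I 1) (d 0) \<and>
     (\<forall>k\<ge>0. d k ` carrier (I k) = a_kernel (I (k + 1)) (I (k + 2)) (d (k + 1)))"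

text \<open>
  \<open>H\<^sup>k\<^sub>a(M)\<close> is the \<open>k\<close>-th right derived functor of \<open>a\<close>-torsion, computed from an injective
  resolution \<open>(I, d)\<close> of \<open>M\<close>.
\<close>

definition local_cohomology ::
    "('a, 'r) ring_scheme \<Rightarrow> 'a set \<Rightarrow> (int \<Rightarrow> ('a, 'e) module) \<Rightarrow> (int \<Rightarrow> 'e \<Rightarrow> 'e) \<Rightarrow> int
       \<Rightarrow> ('a, 'e set) module" where
  "local_cohomology R a I d k = cohomology (\<lambda>j. torsion_part R a (I j)) d k"

definition local_cohomology_map ::
    "('a, 'r) ring_scheme \<Rightarrow> 'a set \<Rightarrow> (int \<Rightarrow> ('a, 'e) module) \<Rightarrow> (int \<Rightarrow> 'e \<Rightarrow> 'e)
       \<Rightarrow> (int \<Rightarrow> 'f \<Rightarrow> 'e) \<Rightarrow> int \<Rightarrow> 'f set \<Rightarrow> 'e set" where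
  "local_cohomology_map R a I d f k = cohomology_map (\<lambda>j. torsion_part R a (I j)) d f k"


section \<open>Formal local cohomology\<close>

definition adic_quotient ::
    "('a, 'r) ring_scheme \<Rightarrow> 'a set \<Rightarrow> ('a, 'm) module \<Rightarrow> nat \<Rightarrow> ('a, 'm set) module" where
  "adic_quotient R a M n = quot_module M (ideal_smult R (ideal_power R a n) M)"

definition adic_projection ::
    "('a, 'r) ring_scheme \<Rightarrow> 'a set \<Rightarrow> ('a, 'm) module \<Rightarrow> nat \<Rightarrow> 'm set \<Rightarrow> 'm set" where
  "adic_projection R a M n = quot_map M (ideal_smult R (ideal_power R a n) M) (\<lambda>x. x)"

text \<open>
  The choices needed to evaluate the derived functors on the tower \<open>M/a\<^sup>n M\<close>: injective resolutions
  \<open>(I n, d n, e n)\<close> of \<open>M/a\<^sup>n M\<close>, and chain maps \<open>\<phi> n : I (n + 1) \<rightarrow> I n\<close> lifting the natural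
  maps \<open>M/a\<^sup>n\<^sup>+\<^sup>1 M \<rightarrow> M/a\<^sup>n M\<close>. By the comparison theorem, different choices yield canonically
  isomorphic formal local cohomology modules, and for a large enough type \<open>'e\<close> choices exist.
\<close>

definition adic_resolutions ::
    "('a, 'r) ring_scheme \<Rightarrow> 'a set \<Rightarrow> ('a, 'm) module \<Rightarrow> (nat \<Rightarrow> int \<Rightarrow> ('a, 'e) module)
       \<Rightarrow> (nat \<Rightarrow> int \<Rightarrow> 'e \<Rightarrow> 'e) \<Rightarrow> (nat \<Rightarrow> 'm set \<Rightarrow> 'e) \<Rightarrow> (nat \<Rightarrow> int \<Rightarrow> 'e \<Rightarrow> 'e) \<Rightarrow> bool" where
  "adic_resolutions R a M I d e \<phi> \<longleftrightarrow>
     (\<forall>n. injective_resolution R (adic_quotient R a M n) (I n) (d n) (e n)) \<and>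
     (\<forall>n k. \<phi> n k \<in> module_hom R (I (Suc n) k) (I n k)) \<and>
     (\<forall>n k. \<forall>x \<in> carrier (I (Suc n) k). \<phi> n (k + 1) (d (Suc n) k x) = d n k (\<phi> n k x)) \<and>
     (\<forall>n. \<forall>X \<in> carrier (adic_quotient R a M (Suc n)).
        \<phi> n 0 (e (Suc n) X) = e n (adic_projection R a M n X))"

text \<open>\<open>lim\<^sub>n H\<^sup>k\<^sub>m(M/a\<^sup>n M)\<close>, where \<open>I\<close>, \<open>d\<close>, \<open>\<phi>\<close> satisfy \<open>adic_resolutions R a M I d e \<phi>\<close>.\<close>

definition formal_local_cohomology ::
    "('a, 'r) ring_scheme \<Rightarrow> 'a set \<Rightarrow> (nat \<Rightarrow> int \<Rightarrow> ('a, 'e) module)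
       \<Rightarrow> (nat \<Rightarrow> int \<Rightarrow> 'e \<Rightarrow> 'e) \<Rightarrow> (nat \<Rightarrow> int \<Rightarrow> 'e \<Rightarrow> 'e) \<Rightarrow> int
       \<Rightarrow> ('a, nat \<Rightarrow> 'e set) module" where
  "formal_local_cohomology R m I d \<phi> k =
     inverse_limit (\<lambda>n. local_cohomology R m (I n) (d n) k)
                   (\<lambda>n. local_cohomology_map R m (I n) (d n) (\<phi> n) k)"


section \<open>Localization at a prime ideal\<close>

text \<open>The fraction \<open>x/s\<close>, as an equivalence class of pairs.\<close>

definition fraction ::
    "('a, 'r) ring_scheme \<Rightarrow> 'a set \<Rightarrow> ('a, 'm) module \<Rightarrow> 'm \<Rightarrow> 'a \<Rightarrow> ('m \<times> 'a) set" where
  "fraction R p M x s =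
     {(y, t). y \<in> carrier M \<and> t \<in> carrier R - p \<and>
        (\<exists>u \<in> carrier R - p. u \<odot>\<^bsub>M\<^esub> (t \<odot>\<^bsub>M\<^esub> x) = u \<odot>\<^bsub>M\<^esub> (s \<odot>\<^bsub>M\<^esub> y))}"

definition local_module ::
    "('a, 'r) ring_scheme \<Rightarrow> 'a set \<Rightarrow> ('a, 'm) module \<Rightarrow> (('a \<times> 'a) set, ('m \<times> 'a) set) module"
  where
  "local_module R p M =
     \<lparr>carrier = {fraction R p M x s |x s. x \<in> carrier M \<and> s \<in> carrier R - p},
      monoid.mult = undefined, one = undefined,
      ring.zero = fraction R p M \<zero>\<^bsub>M\<^esub> \<one>\<^bsub>R\<^esub>,
      add = (\<lambda>X Y. \<Union>(x, s)\<in>X. \<Union>(y, t)\<in>Y.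
               fraction R p M (t \<odot>\<^bsub>M\<^esub> x \<oplus>\<^bsub>M\<^esub> s \<odot>\<^bsub>M\<^esub> y) (s \<otimes>\<^bsub>R\<^esub> t)),
      smult = (\<lambda>A X. \<Union>(r, s)\<in>A. \<Union>(x, t)\<in>X. fraction R p M (r \<odot>\<^bsub>M\<^esub> x) (s \<otimes>\<^bsub>R\<^esub> t))\<rparr>"

definition localization :: "('a, 'r) ring_scheme \<Rightarrow> 'a set \<Rightarrow> ('a \<times> 'a) set ring" where
  "localization R p =
     \<lparr>carrier = carrier (local_module R p (regular_module R)),
      monoid.mult = smult (local_module R p (regular_module R)),
      one = fraction R p (regular_module R) \<one>\<^bsub>R\<^esub> \<one>\<^bsub>R\<^esub>,
      ring.zero = ring.zero (local_module R p (regular_module R)),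
      add = ring.add (local_module R p (regular_module R))\<rparr>"


section \<open>Colocalization and cosupport\<close>

text \<open>
  \<open>is_E R E\<close>: the module \<open>E\<close> is an injective hull \<open>E\<^sub>R\<close> of the direct sum of the residue fields of
  \<open>R\<close>. Injective hulls are unique only up to isomorphism, so the dual, the colocalization and the
  cosupport take the chosen hulls as arguments: \<open>E\<close> for \<open>R\<close>, and \<open>EL p\<close> for the localization
  of \<open>R\<close> at \<open>p\<close>.
\<close>

definition is_E :: "('a, 'r) ring_scheme \<Rightarrow> ('a, 'e) module \<Rightarrow> bool" where
  "is_E R E \<longleftrightarrow>
     injective_hull R
       (direct_sum {n. maximalideal n R} (\<lambda>n. quot_module (regular_module R) n)) E"

definition dual ::
    "('a, 'r) ring_scheme \<Rightarrow> ('a, 'e) module \<Rightarrow> ('a, 'n) module \<Rightarrow> ('a, 'n \<Rightarrow> 'e) module" where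
  "dual R E N = hom_module R N E"

definition colocalization ::
    "('a, 'r) ring_scheme \<Rightarrow> ('a, 'e) module \<Rightarrow> (('a \<times> 'a) set, 'f) module \<Rightarrow> 'a set
       \<Rightarrow> ('a, 'n) module \<Rightarrow> (('a \<times> 'a) set, (('n \<Rightarrow> 'e) \<times> 'a) set \<Rightarrow> 'f) module" where
  "colocalization R E Ep p N =
     dual (localization R p) Ep (local_module R p (dual R E N))"

definition CoSupp ::
    "('a, 'r) ring_scheme \<Rightarrow> ('a, 'e) module \<Rightarrow> ('a set \<Rightarrow> (('a \<times> 'a) set, 'f) module)
       \<Rightarrow> ('a, 'n) module \<Rightarrow> 'a set set" where
  "CoSupp R E EL N =
     {p \<in> Spec R. carrier (colocalization R E (EL p) p N)
                    \<noteq> {\<zero>\<^bsub>colocalization R E (EL p) p N\<^esub>}}"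

end

theory Submission
  imports Defs
begin

text \<open>
  Write \<open>F\<close> for the formal local cohomology module, the inverse limit of the modules
  \<open>H n = H\<^sup>i\<^sub>m(M/a\<^sup>nM)\<close>. The proof shows that a power of \<open>a\<close> annihilates \<open>F\<close>, and that this confines
  the cosupport to \<open>V(a)\<close>.

  Local cohomology is linear over \<open>R\<close>, so \<open>a\<^sup>n\<close> annihilates \<open>H n\<close>. In terms of an injective
  resolution of \<open>M/a\<^sup>nM\<close>: multiplication by \<open>r \<in> a\<^sup>n\<close> lifts the zero map and is therefore
  null-homotopic (\<open>annihilated_resolution_contraction\<close>), and a null-homotopic map induces zero on
  the cohomology of the torsion subcomplex (\<open>local_cohomology_annihilated\<close>).

  The inverse limit alone would only give that \<open>F\<close> is separated in the \<open>a\<close>-adic topology. The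
  Artinian hypothesis turns this into annihilation by one power: the kernels of the projections
  \<open>F \<rightarrow> H n\<close> decrease to zero, so one of them is zero (\<open>artinian_inverse_limit_component\<close>). Hence \<open>F\<close>
  is a submodule of some \<open>H n\<close> and is annihilated by \<open>a\<^sup>n\<close>
  (\<open>formal_local_cohomology_annihilated\<close>).

  Finally let \<open>p\<close> be a prime and \<open>s \<in> a\<close>. If \<open>s\<^sup>n\<close> were outside \<open>p\<close>, it would annihilate
  the dual of \<open>F\<close> and be invertible at \<open>p\<close>, so the dual would localize to zero and the colocalization
  of \<open>F\<close> at \<open>p\<close> would vanish (\<open>colocalization_of_annihilated\<close>). So for \<open>p\<close> in the cosupport
  \<open>s\<^sup>n \<in> p\<close>, whence \<open>s \<in> p\<close>.
\<close>

section \<open>Modules and their homomorphisms\<close>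

text \<open>
  Negatives are scalar multiples by \<open>-1\<close>. So closure under scalars contains closure under negation,
  and in \<open>module_criterion\<close> the law \<open>0 x = 0\<close> yields additive inverses.
\<close>

lemma submodule_criterion:
  assumes M: "module R M" and "H \<subseteq> carrier M" "\<zero>\<^bsub>M\<^esub> \<in> H"
    and "\<And>x y. x \<in> H \<Longrightarrow> y \<in> H \<Longrightarrow> x \<oplus>\<^bsub>M\<^esub> y \<in> H"
    and smult: "\<And>r x. r \<in> carrier R \<Longrightarrow> x \<in> H \<Longrightarrow> r \<odot>\<^bsub>M\<^esub> x \<in> H"
  shows "submodule H R M"
proof -
  interpret module R M by (rule M)
  have "\<ominus>\<^bsub>M\<^esub> x \<in> H" if "x \<in> H" for x
    using smult[of "\<ominus>\<^bsub>R\<^esub> \<one>\<^bsub>R\<^esub>" x] that smult_l_minus[of "\<one>\<^bsub>R\<^esub>" x] assms(2) by auto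
  then show ?thesis
    using assms by (intro submoduleI) auto
qed

lemma module_criterion:
  fixes R (structure) and M (structure)
  assumes R: "cring R"
    and add: "\<And>x y. x \<in> carrier M \<Longrightarrow> y \<in> carrier M \<Longrightarrow> x \<oplus>\<^bsub>M\<^esub> y \<in> carrier M"
    and zero: "\<zero>\<^bsub>M\<^esub> \<in> carrier M"
    and assoc: "\<And>x y z. x \<in> carrier M \<Longrightarrow> y \<in> carrier M \<Longrightarrow> z \<in> carrier M \<Longrightarrow>
      (x \<oplus>\<^bsub>M\<^esub> y) \<oplus>\<^bsub>M\<^esub> z = x \<oplus>\<^bsub>M\<^esub> (y \<oplus>\<^bsub>M\<^esub> z)"
    and comm: "\<And>x y. x \<in> carrier M \<Longrightarrow> y \<in> carrier M \<Longrightarrow> x \<oplus>\<^bsub>M\<^esub> y = y \<oplus>\<^bsub>M\<^esub> x"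
    and l_zero: "\<And>x. x \<in> carrier M \<Longrightarrow> \<zero>\<^bsub>M\<^esub> \<oplus>\<^bsub>M\<^esub> x = x"
    and smult: "\<And>r x. r \<in> carrier R \<Longrightarrow> x \<in> carrier M \<Longrightarrow> r \<odot>\<^bsub>M\<^esub> x \<in> carrier M"
    and l_distr: "\<And>r s x. r \<in> carrier R \<Longrightarrow> s \<in> carrier R \<Longrightarrow> x \<in> carrier M \<Longrightarrow>
      (r \<oplus> s) \<odot>\<^bsub>M\<^esub> x = r \<odot>\<^bsub>M\<^esub> x \<oplus>\<^bsub>M\<^esub> s \<odot>\<^bsub>M\<^esub> x"
    and r_distr: "\<And>r x y. r \<in> carrier R \<Longrightarrow> x \<in> carrier M \<Longrightarrow> y \<in> carrier M \<Longrightarrow>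
      r \<odot>\<^bsub>M\<^esub> (x \<oplus>\<^bsub>M\<^esub> y) = r \<odot>\<^bsub>M\<^esub> x \<oplus>\<^bsub>M\<^esub> r \<odot>\<^bsub>M\<^esub> y"
    and assoc1: "\<And>r s x. r \<in> carrier R \<Longrightarrow> s \<in> carrier R \<Longrightarrow> x \<in> carrier M \<Longrightarrow>
      (r \<otimes> s) \<odot>\<^bsub>M\<^esub> x = r \<odot>\<^bsub>M\<^esub> (s \<odot>\<^bsub>M\<^esub> x)"
    and one: "\<And>x. x \<in> carrier M \<Longrightarrow> \<one> \<odot>\<^bsub>M\<^esub> x = x"
    and null: "\<And>x. x \<in> carrier M \<Longrightarrow> \<zero> \<odot>\<^bsub>M\<^esub> x = \<zero>\<^bsub>M\<^esub>"
  shows "module R M"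
proof -
  interpret R: cring R by (rule R)
  have inv: "\<exists>y\<in>carrier M. y \<oplus>\<^bsub>M\<^esub> x = \<zero>\<^bsub>M\<^esub>" if x: "x \<in> carrier M" for x
  proof (intro bexI[of _ "(\<ominus> \<one>) \<odot>\<^bsub>M\<^esub> x"])
    show "(\<ominus> \<one>) \<odot>\<^bsub>M\<^esub> x \<oplus>\<^bsub>M\<^esub> x = \<zero>\<^bsub>M\<^esub>"
      using l_distr[of "\<ominus> \<one>" \<one> x] x one[OF x] null[OF x] by (simp add: R.l_neg)
  qed (use x smult in simp)
  have "abelian_group M"
    by (rule abelian_groupI) (use add zero assoc comm l_zero inv in auto)
  then show ?thesis
    by (rule moduleI[OF R]) (use smult l_distr r_distr assoc1 one in auto)
qed

lemma module_hom_closed: "f \<in> module_hom R M N \<Longrightarrow> x \<in> carrier M \<Longrightarrow> f x \<in> carrier N"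
  and module_hom_add: "f \<in> module_hom R M N \<Longrightarrow> x \<in> carrier M \<Longrightarrow> y \<in> carrier M \<Longrightarrow>
    f (x \<oplus>\<^bsub>M\<^esub> y) = f x \<oplus>\<^bsub>N\<^esub> f y"
  and module_hom_smult: "f \<in> module_hom R M N \<Longrightarrow> r \<in> carrier R \<Longrightarrow> x \<in> carrier M \<Longrightarrow>
    f (r \<odot>\<^bsub>M\<^esub> x) = r \<odot>\<^bsub>N\<^esub> f x"
  by (auto simp: module_hom_def)

lemma module_hom_zero:
  assumes "module R M" "module R N" "f \<in> module_hom R M N"
  shows "f \<zero>\<^bsub>M\<^esub> = \<zero>\<^bsub>N\<^esub>"
proof -
  interpret M: module R M by fact
  interpret N: module R N by fact
  show ?thesis
    using module_hom_smult[OF assms(3), of "\<zero>\<^bsub>R\<^esub>" "\<zero>\<^bsub>M\<^esub>"] module_hom_closed[OF assms(3), of "\<zero>\<^bsub>M\<^esub>"]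
    by simp
qed

lemma module_hom_minus:
  assumes "module R M" "module R N" "f \<in> module_hom R M N" "x \<in> carrier M" "y \<in> carrier M"
  shows "f (x \<ominus>\<^bsub>M\<^esub> y) = f x \<ominus>\<^bsub>N\<^esub> f y"
proof -
  interpret M: module R M by fact
  interpret N: module R N by fact
  have "f (\<ominus>\<^bsub>M\<^esub> y) = \<ominus>\<^bsub>N\<^esub> f y"
    using module_hom_smult[OF assms(3), of "\<ominus>\<^bsub>R\<^esub> \<one>\<^bsub>R\<^esub>" y] assms
      M.smult_l_minus[of "\<one>\<^bsub>R\<^esub>" y] N.smult_l_minus[of "\<one>\<^bsub>R\<^esub>" "f y"] module_hom_closed[OF assms(3), of y]
    by simp
  then show ?thesis
    using module_hom_add[OF assms(3), of x "\<ominus>\<^bsub>M\<^esub> y"] assms(4,5) by (simp add: a_minus_def)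
qed

lemma minus_eq_zero_iff:
  assumes "abelian_group G" "x \<in> carrier G" "y \<in> carrier G"
  shows "x \<ominus>\<^bsub>G\<^esub> y = \<zero>\<^bsub>G\<^esub> \<longleftrightarrow> x = y"
proof -
  interpret abelian_group G by fact
  show ?thesis
    using assms(2,3) minus_equality[of x "\<ominus>\<^bsub>G\<^esub> y"] by (auto simp: a_minus_def r_neg)
qed

lemma smult_in_module_hom:
  assumes "module R M" "r \<in> carrier R"
  shows "(\<lambda>x. r \<odot>\<^bsub>M\<^esub> x) \<in> module_hom R M M"
proof -
  interpret module R M by fact
  have "r \<odot>\<^bsub>M\<^esub> (s \<odot>\<^bsub>M\<^esub> y) = s \<odot>\<^bsub>M\<^esub> (r \<odot>\<^bsub>M\<^esub> y)" if "s \<in> carrier R" "y \<in> carrier M" for s y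
    using that assms by (metis R.m_comm smult_assoc1)
  then show ?thesis using assms(2) by (auto simp: module_hom_def smult_r_distr)
qed

text \<open>
  Commutativity of \<open>R\<close> is what makes a scalar multiple of a homomorphism a homomorphism again.
\<close>

lemma hom_module_is_module:
  assumes "module R M" "module R N"
  shows "module R (hom_module R M N)"
proof -
  interpret M: module R M by fact
  interpret N: module R N by fact
  show ?thesis
  proof (rule module_criterion)
    fix r f assume "r \<in> carrier R" "f \<in> carrier (hom_module R M N)"
    moreover have "r \<odot>\<^bsub>N\<^esub> (s \<odot>\<^bsub>N\<^esub> y) = s \<odot>\<^bsub>N\<^esub> (r \<odot>\<^bsub>N\<^esub> y)"
      if "r \<in> carrier R" "s \<in> carrier R" "y \<in> carrier N" for r s y
      using that by (metis M.R.m_comm N.smult_assoc1)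
    ultimately show "r \<odot>\<^bsub>hom_module R M N\<^esub> f \<in> carrier (hom_module R M N)"
      by (auto simp: hom_module_def module_hom_def N.smult_r_distr Pi_iff)
  next
    fix f assume "f \<in> carrier (hom_module R M N)"
    then show "\<one>\<^bsub>R\<^esub> \<odot>\<^bsub>hom_module R M N\<^esub> f = f" "\<zero>\<^bsub>hom_module R M N\<^esub> \<oplus>\<^bsub>hom_module R M N\<^esub> f = f"
      "\<zero>\<^bsub>R\<^esub> \<odot>\<^bsub>hom_module R M N\<^esub> f = \<zero>\<^bsub>hom_module R M N\<^esub>"
      by (auto simp: hom_module_def module_hom_def Pi_iff extensional_def intro!: ext)
  qed (auto simp: hom_module_def module_hom_def Pi_iff M.R.is_cring N.smult_r_distr N.smult_l_distr
      N.smult_assoc1 N.add.m_ac intro!: ext)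
qed

section \<open>Quotient modules\<close>

text \<open>
  Operations on equivalence classes are written as unions over all representatives. Such a union is
  computed from one representative once its members are known to agree.
\<close>

lemma UN_constant:
  assumes "\<And>y. y \<in> X \<Longrightarrow> g y = c" "x \<in> X"
  shows "(\<Union>y\<in>X. g y) = c"
  using assms by auto

lemma submodule_abelian_subgroup:
  assumes "module R M" "submodule N R M"
  shows "abelian_subgroup N M"
  using assms by (intro abelian_subgroupI3 additive_subgroupI) (auto simp: submodule_def module_def)

lemma coset_eqI:
  assumes M: "module R M" and N: "submodule N R M"
    and y: "y \<in> carrier M" and x: "x \<in> N +>\<^bsub>M\<^esub> y"
  shows "N +>\<^bsub>M\<^esub> x = N +>\<^bsub>M\<^esub> y"
proof -
  interpret abelian_subgroup N M by (rule submodule_abelian_subgroup[OF M N])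
  show ?thesis using a_repr_independence'[OF x y] by simp
qed

lemma quot_map_coset:
  assumes M': "module R M'" and N': "submodule N' R M'" and M: "module R M" and N: "submodule N R M"
    and f: "f \<in> module_hom R M' M" and fN: "f ` N' \<subseteq> N" and x: "x \<in> carrier M'"
  shows "quot_map M N f (N' +>\<^bsub>M'\<^esub> x) = N +>\<^bsub>M\<^esub> f x"
proof -
  interpret M': abelian_subgroup N' M' by (rule submodule_abelian_subgroup[OF M' N'])
  interpret M: abelian_subgroup N M by (rule submodule_abelian_subgroup[OF M N])
  show ?thesis
    unfolding quot_map_def
  proof (rule UN_constant)
    show "x \<in> N' +>\<^bsub>M'\<^esub> x" using x by (rule M'.a_rcos_self)
    fix y assume "y \<in> N' +>\<^bsub>M'\<^esub> x"
    then obtain n where n: "n \<in> N'" "y = n \<oplus>\<^bsub>M'\<^esub> x" by (auto simp: a_r_coset_def')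
    then have "f y = f n \<oplus>\<^bsub>M\<^esub> f x" using x by (simp add: module_hom_add[OF f])
    then have "f y \<in> N +>\<^bsub>M\<^esub> f x" using n fN by (auto simp: a_r_coset_def')
    then show "N +>\<^bsub>M\<^esub> f y = N +>\<^bsub>M\<^esub> f x"
      by (rule coset_eqI[OF M N module_hom_closed[OF f x]])
  qed
qed

text \<open>
  Scalar multiplication on a quotient is the map induced by multiplication by \<open>r\<close>.
\<close>

lemma quot_module_smult:
  assumes M: "module R M" and N: "submodule N R M" and r: "r \<in> carrier R" and x: "x \<in> carrier M"
  shows "r \<odot>\<^bsub>quot_module M N\<^esub> (N +>\<^bsub>M\<^esub> x) = N +>\<^bsub>M\<^esub> (r \<odot>\<^bsub>M\<^esub> x)"
  using quot_map_coset[OF M N M N smult_in_module_hom[OF M r] _ x] submodule.smult_closed[OF N r]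
  by (auto simp: quot_module_def quot_map_def)

lemma quot_module_carrier:
  "carrier (quot_module M N) = (\<lambda>x. N +>\<^bsub>M\<^esub> x) ` carrier M"
  by (auto simp: quot_module_def A_RCOSETS_def')

lemma quot_module_add:
  assumes M: "module R M" and N: "submodule N R M" and x: "x \<in> carrier M" "y \<in> carrier M"
  shows "(N +>\<^bsub>M\<^esub> x) \<oplus>\<^bsub>quot_module M N\<^esub> (N +>\<^bsub>M\<^esub> y) = N +>\<^bsub>M\<^esub> (x \<oplus>\<^bsub>M\<^esub> y)"
proof -
  interpret abelian_subgroup N M by (rule submodule_abelian_subgroup[OF M N])
  show ?thesis using a_rcos_sum[OF x] by (simp add: quot_module_def)
qed

lemma quot_module_zero:
  assumes M: "module R M" and N: "submodule N R M"
  shows "\<zero>\<^bsub>quot_module M N\<^esub> = N +>\<^bsub>M\<^esub> \<zero>\<^bsub>M\<^esub>"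
proof -
  interpret abelian_subgroup N M by (rule submodule_abelian_subgroup[OF M N])
  show ?thesis using a_coset_add_zero[OF a_subset] by (simp add: quot_module_def)
qed

lemma coset_of_member:
  assumes M: "module R M" and N: "submodule N R M" and x: "x \<in> N"
  shows "N +>\<^bsub>M\<^esub> x = \<zero>\<^bsub>quot_module M N\<^esub>"
proof -
  interpret module R M by (rule M)
  interpret N: abelian_subgroup N M by (rule submodule_abelian_subgroup[OF M N])
  have "x \<in> N +>\<^bsub>M\<^esub> \<zero>\<^bsub>M\<^esub>" using x a_coset_add_zero[OF N.a_subset] by simp
  then show ?thesis using coset_eqI[OF M N] quot_module_zero[OF M N] by auto
qed

lemma quot_module_is_module:
  assumes M: "module R M" and N: "submodule N R M"
  shows "module R (quot_module M N)"
proof -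
  interpret module R M by (rule M)
  note [simp] = quot_module_add[OF M N] quot_module_smult[OF M N] quot_module_zero[OF M N]
  show ?thesis
    by (rule module_criterion)
      (auto simp: quot_module_carrier R.is_cring smult_l_distr smult_r_distr smult_assoc1 M.add.m_ac)
qed

lemma quot_map_in_module_hom:
  assumes M': "module R M'" and N': "submodule N' R M'" and M: "module R M" and N: "submodule N R M"
    and f: "f \<in> module_hom R M' M" and fN: "f ` N' \<subseteq> N"
  shows "quot_map M N f \<in> module_hom R (quot_module M' N') (quot_module M N)"
proof -
  interpret M': module R M' by (rule M')
  show ?thesis
    using quot_map_coset[OF assms] module_hom_closed[OF f]
    by (auto simp: module_hom_def quot_module_carrier quot_module_add[OF M' N'] quot_module_add[OF M N]
        quot_module_smult[OF M' N'] quot_module_smult[OF M N] module_hom_add[OF f] module_hom_smult[OF f])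
qed

section \<open>Inverse limits\<close>

lemma inverse_limit_is_module:
  assumes H: "\<And>n. module R (H n)" and t: "\<And>n. t n \<in> module_hom R (H (Suc n)) (H n)"
  shows "module R (inverse_limit H t)"
proof -
  interpret H: module R "H n" for n by (rule H)
  show ?thesis
    by (rule module_criterion)
      (auto simp: inverse_limit_def H.R.is_cring H.smult_l_distr H.smult_r_distr H.smult_assoc1
        H.M.add.m_ac module_hom_zero[OF H H t] module_hom_add[OF t] module_hom_smult[OF t])
qed

section \<open>Powers of an ideal\<close>

lemma ideal_power_is_ideal:
  assumes "cring R" "ideal a R"
  shows "ideal (ideal_power R a n) R"
proof -
  interpret cring R by fact
  show ?thesis by (induction n) (auto simp: oneideal intro: ideal_prod_is_ideal assms)
qed

lemma ideal_power_antimono: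
  assumes "cring R" "ideal a R" "n \<le> k"
  shows "ideal_power R a k \<subseteq> ideal_power R a n"
proof -
  interpret cring R by fact
  have "ideal_power R a (Suc j) \<subseteq> ideal_power R a j" for j
    using ideal_prod_inter[OF assms(2) ideal_power_is_ideal[OF assms(1,2)]] by auto
  then show ?thesis using assms(3) by (rule lift_Suc_antimono_le)
qed

lemma power_in_ideal_power:
  assumes "cring R" "ideal a R" "s \<in> a"
  shows "s [^]\<^bsub>R\<^esub> (n :: nat) \<in> ideal_power R a n"
proof -
  interpret cring R by fact
  interpret ideal a R by fact
  have "s \<in> carrier R" using assms(3) by auto
  then show ?thesis
    using assms(3) by (induction n) (auto simp: m_comm intro: ideal_prod.prod)
qed

lemma torsion_part_submodule:
  assumes a: "ideal a R" and M: "module R M"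
  shows "submodule (carrier (torsion_part R a M)) R M"
proof -
  interpret module R M by (rule M)
  note R = R.is_cring
  note subset = ideal.Icarr[OF ideal_power_is_ideal[OF R a]]
  show ?thesis
  proof (rule submodule_criterion[OF M])
    fix x y assume "x \<in> carrier (torsion_part R a M)" "y \<in> carrier (torsion_part R a M)"
    then obtain n k where xy: "x \<in> carrier M" "y \<in> carrier M"
      and n: "\<And>r. r \<in> ideal_power R a n \<Longrightarrow> r \<odot>\<^bsub>M\<^esub> x = \<zero>\<^bsub>M\<^esub>"
      and k: "\<And>r. r \<in> ideal_power R a k \<Longrightarrow> r \<odot>\<^bsub>M\<^esub> y = \<zero>\<^bsub>M\<^esub>"
      by (auto simp: torsion_part_def)
    have "r \<odot>\<^bsub>M\<^esub> (x \<oplus>\<^bsub>M\<^esub> y) = \<zero>\<^bsub>M\<^esub>" if "r \<in> ideal_power R a (max n k)" for r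
    proof -
      have "r \<in> ideal_power R a n" "r \<in> ideal_power R a k"
        using that ideal_power_antimono[OF R a] by (meson max.cobounded1 max.cobounded2 subsetD)+
      then show ?thesis using xy n k subset[of r] by (simp add: smult_r_distr)
    qed
    then show "x \<oplus>\<^bsub>M\<^esub> y \<in> carrier (torsion_part R a M)"
      using xy by (auto simp: torsion_part_def)
  next
    fix r x assume r: "r \<in> carrier R" and "x \<in> carrier (torsion_part R a M)"
    then obtain n where x: "x \<in> carrier M"
      and n: "\<And>s. s \<in> ideal_power R a n \<Longrightarrow> s \<odot>\<^bsub>M\<^esub> x = \<zero>\<^bsub>M\<^esub>"
      by (auto simp: torsion_part_def)
    have "s \<odot>\<^bsub>M\<^esub> (r \<odot>\<^bsub>M\<^esub> x) = \<zero>\<^bsub>M\<^esub>" if "s \<in> ideal_power R a n" for s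
      using n[OF that] subset[OF that] r x
      by (metis R.m_comm smult_assoc1 smult_r_null)
    then show "r \<odot>\<^bsub>M\<^esub> x \<in> carrier (torsion_part R a M)"
      using r x by (auto simp: torsion_part_def)
  qed (use subset[of _ 0] in \<open>auto simp: torsion_part_def intro!: exI[of _ 0]\<close>)
qed

lemma torsion_part_is_module:
  assumes "ideal a R" "module R M"
  shows "module R (torsion_part R a M)"
  using submodule.submodule_is_module[OF torsion_part_submodule[OF assms] assms(2)]
  by (simp add: torsion_part_def)

text \<open>
  A homomorphism preserves the annihilator condition that defines torsion. Hence a differential, a
  chain map or a contraction between injective modules restricts to the torsion parts.
\<close>

lemma torsion_part_map:
  assumes a: "ideal a R" and M: "module R M" and N: "module R N" and f: "f \<in> module_hom R M N"
  shows "f \<in> module_hom R (torsion_part R a M) (torsion_part R a N)"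
proof -
  interpret M: module R M by (rule M)
  have ann: "r \<odot>\<^bsub>N\<^esub> f x = \<zero>\<^bsub>N\<^esub>"
    if "r \<in> ideal_power R a n" "x \<in> carrier M" "r \<odot>\<^bsub>M\<^esub> x = \<zero>\<^bsub>M\<^esub>" for n r x
  proof -
    have "r \<in> carrier R"
      using that(1) ideal.Icarr[OF ideal_power_is_ideal[OF M.R.is_cring a]] by blast
    then show ?thesis
      using that module_hom_smult[OF f, of r x] module_hom_zero[OF M N f] by simp
  qed
  have "f x \<in> carrier (torsion_part R a N)" if "x \<in> carrier (torsion_part R a M)" for x
  proof -
    from that obtain n where "x \<in> carrier M" "\<And>r. r \<in> ideal_power R a n \<Longrightarrow> r \<odot>\<^bsub>M\<^esub> x = \<zero>\<^bsub>M\<^esub>"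
      by (auto simp: torsion_part_def)
    then show ?thesis using ann module_hom_closed[OF f] by (auto simp: torsion_part_def intro!: exI[of _ n])
  qed
  then show ?thesis
    using f by (simp add: module_hom_def torsion_part_def)
qed

lemma ideal_smult_submodule:
  assumes a: "ideal a R" and M: "module R M"
  shows "submodule (ideal_smult R a M) R M"
proof -
  interpret module R M by (rule M)
  have "submodule (carrier M) R M" by (rule carrier_is_submodule)
  moreover have "{r \<odot>\<^bsub>M\<^esub> x |r x. r \<in> a \<and> x \<in> carrier M} \<subseteq> carrier M"
    using ideal.Icarr[OF a] by auto
  ultimately show ?thesis
    unfolding ideal_smult_def module_span_def
    by (intro submodule_criterion[OF M])
      (auto intro: submoduleE(5) submodule.smult_closed
        subgroup.one_closed[of _ "add_monoid M", simplified] submodule.axioms(1))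
qed

lemma adic_quotient_is_module:
  assumes "cring R" "ideal a R" "module R M"
  shows "module R (adic_quotient R a M n)"
  unfolding adic_quotient_def
  by (intro quot_module_is_module ideal_smult_submodule ideal_power_is_ideal assms)

text \<open>
  By construction \<open>a\<^sup>n\<close> maps \<open>M\<close> into the submodule \<open>a\<^sup>n M\<close> that is divided out.
\<close>

lemma adic_quotient_annihilated:
  assumes R: "cring R" and a: "ideal a R" and M: "module R M"
    and r: "r \<in> ideal_power R a n" and X: "X \<in> carrier (adic_quotient R a M n)"
  shows "r \<odot>\<^bsub>adic_quotient R a M n\<^esub> X = \<zero>\<^bsub>adic_quotient R a M n\<^esub>"
proof -
  let ?N = "ideal_smult R (ideal_power R a n) M"
  have N: "submodule ?N R M" by (intro ideal_smult_submodule ideal_power_is_ideal R a M)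
  from X obtain x where x: "x \<in> carrier M" "X = ?N +>\<^bsub>M\<^esub> x"
    by (auto simp: adic_quotient_def quot_module_carrier)
  have "r \<in> carrier R" using r ideal.Icarr[OF ideal_power_is_ideal[OF R a]] by blast
  moreover have "r \<odot>\<^bsub>M\<^esub> x \<in> ?N"
    using r x by (auto simp: ideal_smult_def module_span_def)
  ultimately show ?thesis
    using x by (simp add: adic_quotient_def quot_module_smult[OF M N] coset_of_member[OF M N])
qed

section \<open>Complexes and cohomology\<close>

definition cochain_complex ::
    "('a, 'r) ring_scheme \<Rightarrow> (int \<Rightarrow> ('a, 'm) module) \<Rightarrow> (int \<Rightarrow> 'm \<Rightarrow> 'm) \<Rightarrow> bool" where
  "cochain_complex R C d \<longleftrightarrow>
     (\<forall>k. module R (C k)) \<and> (\<forall>k. d k \<in> module_hom R (C k) (C (k + 1))) \<and>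
     (\<forall>k. \<forall>x\<in>carrier (C k). d (k + 1) (d k x) = \<zero>\<^bsub>C (k + 2)\<^esub>)"

lemma a_kernel_iff: "x \<in> a_kernel M N f \<longleftrightarrow> x \<in> carrier M \<and> f x = \<zero>\<^bsub>N\<^esub>"
  by (simp add: a_kernel_def')

lemma a_kernel_submodule:
  assumes "module R M" "module R N" "f \<in> module_hom R M N"
  shows "submodule (a_kernel M N f) R M"
proof -
  interpret M: module R M by fact
  interpret N: module R N by fact
  show ?thesis
    by (rule submodule_criterion[OF assms(1)])
      (auto simp: a_kernel_iff module_hom_add[OF assms(3)] module_hom_smult[OF assms(3)]
        module_hom_zero[OF assms])
qed

lemma image_submodule:
  assumes "module R M" "module R N" "f \<in> module_hom R M N"
  shows "submodule (f ` carrier M) R N"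
proof -
  interpret M: module R M by fact
  interpret N: module R N by fact
  show ?thesis
  proof (rule submodule_criterion[OF assms(2)])
    show "\<zero>\<^bsub>N\<^esub> \<in> f ` carrier M"
      using module_hom_zero[OF assms] by (metis M.M.zero_closed imageI)
  qed (auto simp: module_hom_closed[OF assms(3)] simp flip: module_hom_add[OF assms(3)] module_hom_smult[OF assms(3)])
qed

lemma cocycles_module:
  assumes "cochain_complex R C d"
  shows "module R (cocycles C d k)"
  using assms submodule.submodule_is_module[OF a_kernel_submodule]
  unfolding cocycles_def cochain_complex_def by blast

lemma coboundaries_submodule:
  assumes "cochain_complex R C d"
  shows "submodule (coboundaries C d k) R (cocycles C d k)"
proof -
  have C: "module R (C j)" and d: "d j \<in> module_hom R (C j) (C (j + 1))"
    and dd: "x \<in> carrier (C j) \<Longrightarrow> d (j + 1) (d j x) = \<zero>\<^bsub>C (j + 2)\<^esub>" for j x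
    using assms by (auto simp: cochain_complex_def)
  have d': "d (k - 1) \<in> module_hom R (C (k - 1)) (C k)" using d[of "k - 1"] by simp
  have "coboundaries C d k \<subseteq> carrier (cocycles C d k)"
    using module_hom_closed[OF d'] dd[of _ "k - 1"]
    by (auto simp: coboundaries_def cocycles_def a_kernel_iff add.commute)
  then show ?thesis
    using image_submodule[OF C C d'] module.submoduleE(1)[OF C, of _ k]
    by (intro submodule_criterion[OF cocycles_module[OF assms]])
      (auto simp: cocycles_def coboundaries_def submodule_def submodule_axioms_def
        dest: subgroup.one_closed subgroup.m_closed)
qed

lemma cohomology_is_module:
  assumes "cochain_complex R C d"
  shows "module R (cohomology C d k)"
  unfolding cohomology_def
  by (rule quot_module_is_module[OF cocycles_module[OF assms] coboundaries_submodule[OF assms]])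

lemma cohomology_map_in_module_hom:
  assumes C': "cochain_complex R C' d'" and C: "cochain_complex R C d"
    and f: "\<And>k. f k \<in> module_hom R (C' k) (C k)"
    and fd: "\<And>k x. x \<in> carrier (C' k) \<Longrightarrow> f (k + 1) (d' k x) = d k (f k x)"
  shows "cohomology_map C d f k \<in> module_hom R (cohomology C' d' k) (cohomology C d k)"
  unfolding cohomology_map_def cohomology_def
proof (rule quot_map_in_module_hom[OF cocycles_module[OF C'] coboundaries_submodule[OF C']
    cocycles_module[OF C] coboundaries_submodule[OF C]])
  have mod: "module R (C' j)" "module R (C j)" for j
    using C C' by (simp_all add: cochain_complex_def)
  have "d k (f k x) = \<zero>\<^bsub>C (k + 1)\<^esub>" if "x \<in> carrier (C' k)" "d' k x = \<zero>\<^bsub>C' (k + 1)\<^esub>" for x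
    using that fd[of x k] module_hom_zero[OF mod f[of "k + 1"]] by simp
  then show "f k \<in> module_hom R (cocycles C' d' k) (cocycles C d k)"
    using f[of k] by (auto simp: module_hom_def cocycles_def a_kernel_iff)
  show "f k ` coboundaries C' d' k \<subseteq> coboundaries C d k"
    using fd[of _ "k - 1"] module_hom_closed[OF f[of "k - 1"]] by (auto simp: coboundaries_def)
qed

lemma torsion_part_complex:
  assumes "ideal a R" "cochain_complex R C d"
  shows "cochain_complex R (\<lambda>k. torsion_part R a (C k)) d"
  unfolding cochain_complex_def
proof (intro conjI allI ballI)
  have C: "module R (C k)" for k using assms(2) by (simp add: cochain_complex_def)
  show "module R (torsion_part R a (C k))" for k
    by (rule torsion_part_is_module[OF assms(1) C])
  show "d k \<in> module_hom R (torsion_part R a (C k)) (torsion_part R a (C (k + 1)))" for k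
    using assms(2) by (intro torsion_part_map assms(1) C) (simp add: cochain_complex_def)
  show "d (k + 1) (d k x) = \<zero>\<^bsub>torsion_part R a (C (k + 2))\<^esub>" if "x \<in> carrier (torsion_part R a (C k))" for k x
    using assms(2) that by (simp add: cochain_complex_def torsion_part_def)
qed

lemma injective_resolutionD:
  assumes "injective_resolution R M I d e"
  shows "injective_module R (I k)" "module R (I k)" "d k \<in> module_hom R (I k) (I (k + 1))"
    "k < 0 \<Longrightarrow> carrier (I k) = {\<zero>\<^bsub>I k\<^esub>}"
    "k \<ge> 0 \<Longrightarrow> d k ` carrier (I k) = a_kernel (I (k + 1)) (I (k + 2)) (d (k + 1))"
    "e \<in> module_hom R M (I 0)" "e ` carrier M = a_kernel (I 0) (I 1) (d 0)"
proof -
  note res = assms[unfolded injective_resolution_def]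
  show inj: "injective_module R (I k)" by (rule conjunct1[OF res, rule_format])
  show "module R (I k)" using inj unfolding injective_module_def by (rule conjunct1)
  note res = conjunct2[OF res]
  show "k < 0 \<Longrightarrow> carrier (I k) = {\<zero>\<^bsub>I k\<^esub>}" by (rule conjunct1[OF res, rule_format])
  note res = conjunct2[OF res]
  show "d k \<in> module_hom R (I k) (I (k + 1))" by (rule conjunct1[OF res, rule_format])
  note res = conjunct2[OF res]
  show "e \<in> module_hom R M (I 0)" by (rule conjunct1[OF res])
  note res = conjunct2[OF conjunct2[OF res]]
  show "e ` carrier M = a_kernel (I 0) (I 1) (d 0)" by (rule conjunct1[OF res])
  show "k \<ge> 0 \<Longrightarrow> d k ` carrier (I k) = a_kernel (I (k + 1)) (I (k + 2)) (d (k + 1))"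
    by (rule conjunct2[OF res, rule_format])
qed

text \<open>
  Exactness gives \<open>d\<^sup>2 = 0\<close> from degree \<open>0\<close> on. Below, it holds because the terms vanish; in
  particular the map from degree \<open>-1\<close> to degree \<open>0\<close> is zero.
\<close>

lemma injective_resolution_complex:
  assumes "injective_resolution R M I d e"
  shows "cochain_complex R I d"
proof -
  note I = injective_resolutionD(2)[OF assms] and d = injective_resolutionD(3)[OF assms]
    and neg = injective_resolutionD(4)[OF assms] and ex = injective_resolutionD(5)[OF assms]
  have "d (k + 1) (d k x) = \<zero>\<^bsub>I (k + 2)\<^esub>" if x: "x \<in> carrier (I k)" for k x
  proof (cases "k \<ge> 0")
    case True
    have "d k x \<in> d k ` carrier (I k)" using x by (rule imageI)
    then show ?thesis unfolding ex[OF True] a_kernel_iff by simp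
  next
    case False
    then have "d k x = \<zero>\<^bsub>I (k + 1)\<^esub>" using neg[of k] x module_hom_zero[OF I I d[of k]] by auto
    then show ?thesis using module_hom_zero[OF I I d[of "k + 1"]] by (simp add: add.assoc)
  qed
  then show ?thesis using I d by (auto simp: cochain_complex_def)
qed

section \<open>Scalars that annihilate a module annihilate its local cohomology\<close>

text \<open>
  Injectivity is phrased with test modules over a sum type. The right copy carries a module on the
  second summand into that type.
\<close>

definition right_copy :: "('a, 'm) module \<Rightarrow> ('a, 'b + 'm) module" where
  "right_copy M =
     \<lparr>carrier = Inr ` carrier M, monoid.mult = undefined, one = undefined,
      ring.zero = Inr \<zero>\<^bsub>M\<^esub>, add = (\<lambda>x y. Inr (projr x \<oplus>\<^bsub>M\<^esub> projr y)),
      smult = (\<lambda>r x. Inr (r \<odot>\<^bsub>M\<^esub> projr x))\<rparr>"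

lemma right_copy_is_module:
  assumes "module R M"
  shows "module R (right_copy M)"
proof -
  interpret module R M by fact
  show ?thesis
    by (rule module_criterion)
      (auto simp: right_copy_def R.is_cring smult_l_distr smult_r_distr smult_assoc1 M.add.m_ac)
qed

text \<open>
  A homomorphism \<open>g\<close> to an injective module that kills the kernel of \<open>f\<close> factors through the image
  of \<open>f\<close>; injectivity extends the factor from the image to all of \<open>B\<close>. The module
  \<open>B\<close> lives in the same type as \<open>E\<close>, as do the terms of a resolution, so \<open>B\<close> and the image of \<open>f\<close>
  have copies among the test modules.
\<close>

lemma injective_module_factor:
  fixes A :: "('a, 'n) module" and B E :: "('a, 'e) module"
  assumes E: "injective_module R E" and A: "module R A" and B: "module R B"
    and f: "f \<in> module_hom R A B" and g: "g \<in> module_hom R A E"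
    and ker: "\<And>x. x \<in> carrier A \<Longrightarrow> f x = \<zero>\<^bsub>B\<^esub> \<Longrightarrow> g x = \<zero>\<^bsub>E\<^esub>"
  obtains h where "h \<in> module_hom R B E" "\<And>x. x \<in> carrier A \<Longrightarrow> h (f x) = g x"
proof -
  interpret A: module R A by (rule A)
  interpret B: module R B by (rule B)
  interpret E: module R E using E by (simp add: injective_module_def)
  let ?C = "B\<lparr>carrier := f ` carrier A\<rparr>"
  let ?g = "\<lambda>z. g (inv_into (carrier A) f (projr z))"
  have C: "module R ?C"
    using submodule.submodule_is_module[OF image_submodule[OF A B f] B] .
  have welldef: "g (inv_into (carrier A) f (f x)) = g x" if x: "x \<in> carrier A" for x
  proof -
    define y where "y = inv_into (carrier A) f (f x)"
    have y: "y \<in> carrier A" "f y = f x"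
      using x by (auto simp: y_def inv_into_into f_inv_into_f)
    have "f (y \<ominus>\<^bsub>A\<^esub> x) = \<zero>\<^bsub>B\<^esub>"
      using module_hom_minus[OF A B f y(1) x] y module_hom_closed[OF f x]
      by (simp add: B.M.r_neg a_minus_def)
    then have "g y \<ominus>\<^bsub>E\<^esub> g x = \<zero>\<^bsub>E\<^esub>"
      using ker[of "y \<ominus>\<^bsub>A\<^esub> x"] module_hom_minus[OF A E.module_axioms g y(1) x] x y by simp
    then show ?thesis
      using x y module_hom_closed[OF g] minus_eq_zero_iff[OF E.M.abelian_group_axioms]
      by (simp add: y_def)
  qed
  have id: "(\<lambda>x. x) \<in> module_hom R (right_copy ?C :: ('a, 'a + 'e) module) (right_copy B)"
    using module_hom_closed[OF f] by (auto simp: module_hom_def right_copy_def)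
  have g': "?g \<in> module_hom R (right_copy ?C :: ('a, 'a + 'e) module) E"
    using welldef
    by (auto simp: module_hom_def right_copy_def module_hom_closed[OF g] module_hom_add[OF g]
        module_hom_smult[OF g] simp flip: module_hom_add[OF f] module_hom_smult[OF f])
  note ext = conjunct2[OF E[unfolded injective_module_def], rule_format,
      of "right_copy ?C" "right_copy B" "\<lambda>x. x" ?g]
  obtain h where h: "h \<in> module_hom R (right_copy B :: ('a, 'a + 'e) module) E"
    and hg: "\<And>x. x \<in> carrier (right_copy ?C) \<Longrightarrow> h x = ?g x"
    using ext[OF conjI[OF right_copy_is_module[OF C] conjI[OF right_copy_is_module[OF B]
        conjI[OF id conjI[OF inj_on_id2 g']]]]]
    by blast
  show thesis
  proof
    show "(\<lambda>x. h (Inr x)) \<in> module_hom R B E"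
      using h by (auto simp: module_hom_def right_copy_def)
    show "h (Inr (f x)) = g x" if "x \<in> carrier A" for x
      using hg[of "Inr (f x)"] welldef[OF that] that by (auto simp: right_copy_def)
  qed
qed

text \<open>
  Multiplication by \<open>r\<close> on the resolution lifts the zero map of \<open>M\<close>, so it is null-homotopic. The
  homotopy is built degree by degree. Only its restriction to the cocycles is recorded: there the
  homotopy equation \<open>r = d h + h d\<close> loses its second summand, and this weaker statement already carries
  the induction. Given \<open>h\<close> in degree \<open>k\<close>, the map \<open>r - d h\<close> kills the cocycles, hence factors
  through \<open>d\<close> as \<open>h' d\<close>; applying \<open>d\<close> to \<open>h' d x = r x - d h x\<close> yields \<open>d h' y = r y\<close> for
  \<open>y = d x\<close>, and every cocycle in degree \<open>k + 1\<close> has this form.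
\<close>

lemma annihilated_resolution_contraction:
  assumes M: "module R M" and res: "injective_resolution R M I d e"
    and r: "r \<in> carrier R" and rM: "\<And>x. x \<in> carrier M \<Longrightarrow> r \<odot>\<^bsub>M\<^esub> x = \<zero>\<^bsub>M\<^esub>"
  shows "\<exists>h \<in> module_hom R (I k) (I (k - 1)). \<forall>x \<in> a_kernel (I k) (I (k + 1)) (d k).
           r \<odot>\<^bsub>I k\<^esub> x = d (k - 1) (h x)"
proof -
  note inj = injective_resolutionD(1)[OF res] and I = injective_resolutionD(2)[OF res]
    and d = injective_resolutionD(3)[OF res] and neg = injective_resolutionD(4)[OF res]
    and ex = injective_resolutionD(5)[OF res] and e = injective_resolutionD(6)[OF res]
    and exe = injective_resolutionD(7)[OF res]
  have d': "d (j - 1) \<in> module_hom R (I (j - 1)) (I j)" for j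
    using d[of "j - 1"] by simp
  have dd: "d j (d (j - 1) x) = \<zero>\<^bsub>I (j + 1)\<^esub>" if "x \<in> carrier (I (j - 1))" for j x
    using injective_resolution_complex[OF res] that
    unfolding cochain_complex_def by (smt (verit) diff_add_cancel)
  interpret I: module R "I j" for j by (rule I)
  have zero_hom: "(\<lambda>x. \<zero>\<^bsub>I j\<^esub>) \<in> module_hom R (I l) (I j)" for j l
    by (auto simp: module_hom_def)
  show ?thesis
  proof (cases "k \<ge> 0")
    case False
    then show ?thesis
      using neg[of k] zero_hom[of "k - 1" k] module_hom_zero[OF I I d'[of k]] r
      by (intro bexI[of _ "\<lambda>x. \<zero>\<^bsub>I (k - 1)\<^esub>"]) (auto simp: a_kernel_iff)
  next
    case True
    then show ?thesis
    proof (induction k rule: int_ge_induct)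
      case base
      have "r \<odot>\<^bsub>I 0\<^esub> x = \<zero>\<^bsub>I 0\<^esub>" if "x \<in> a_kernel (I 0) (I 1) (d 0)" for x
      proof -
        from that obtain y where y: "y \<in> carrier M" "x = e y" using exe by blast
        then have "r \<odot>\<^bsub>I 0\<^esub> x = e (r \<odot>\<^bsub>M\<^esub> y)" using module_hom_smult[OF e r] by simp
        then show ?thesis using rM y module_hom_zero[OF M I e] by simp
      qed
      then show ?case
        using zero_hom[of "-1" 0] module_hom_zero[OF I I d'[of 0]]
        by (intro bexI[of _ "\<lambda>x. \<zero>\<^bsub>I (-1)\<^esub>"]) auto
    next
      case (step k)
      then obtain h where h: "h \<in> module_hom R (I k) (I (k - 1))"
        and hd: "\<And>x. x \<in> carrier (I k) \<Longrightarrow> d k x = \<zero>\<^bsub>I (k + 1)\<^esub> \<Longrightarrow> r \<odot>\<^bsub>I k\<^esub> x = d (k - 1) (h x)"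
        by (auto simp: a_kernel_iff)
      \<comment> \<open>\<open>r - d h\<close>, with the difference written by means of the scalar \<open>-1\<close> so that linearity is
        an instance of linearity in each summand\<close>
      define g where "g = (\<lambda>x. r \<odot>\<^bsub>I k\<^esub> x \<oplus>\<^bsub>I k\<^esub> (\<ominus>\<^bsub>R\<^esub> \<one>\<^bsub>R\<^esub>) \<odot>\<^bsub>I k\<^esub> d (k - 1) (h x))"
      have g_eq: "g x = r \<odot>\<^bsub>I k\<^esub> x \<ominus>\<^bsub>I k\<^esub> d (k - 1) (h x)" if "x \<in> carrier (I k)" for x
        using that module_hom_closed[OF d' module_hom_closed[OF h that]] I.smult_l_minus[of "\<one>\<^bsub>R\<^esub>"]
        by (simp add: g_def a_minus_def)
      have swap: "s \<odot>\<^bsub>I k\<^esub> (t \<odot>\<^bsub>I k\<^esub> x) = t \<odot>\<^bsub>I k\<^esub> (s \<odot>\<^bsub>I k\<^esub> x)"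
        if "s \<in> carrier R" "t \<in> carrier R" "x \<in> carrier (I k)" for s t x
        using that by (metis I.R.m_comm I.smult_assoc1)
      have g: "g \<in> module_hom R (I k) (I k)"
        unfolding g_def module_hom_def
        using r
        by (auto simp: module_hom_closed[OF d'] module_hom_closed[OF h] module_hom_add[OF d']
            module_hom_add[OF h] module_hom_smult[OF d'] module_hom_smult[OF h]
            I.smult_r_distr I.M.add.m_ac swap)
      have "g x = \<zero>\<^bsub>I k\<^esub>" if "x \<in> carrier (I k)" "d k x = \<zero>\<^bsub>I (k + 1)\<^esub>" for x
        using g_eq[OF that(1)] hd[OF that] that(1) r I.smult_closed[OF r that(1)]
        by (simp add: minus_eq_zero_iff[OF I.M.abelian_group_axioms])
      with injective_module_factor[OF inj I I d g]
      obtain h' where h': "h' \<in> module_hom R (I (k + 1)) (I k)"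
        and h'd: "\<And>x. x \<in> carrier (I k) \<Longrightarrow> h' (d k x) = g x"
        by blast
      have "r \<odot>\<^bsub>I (k + 1)\<^esub> y = d k (h' y)" if "y \<in> a_kernel (I (k + 1)) (I (k + 2)) (d (k + 1))" for y
      proof -
        from that obtain x where x: "x \<in> carrier (I k)" "y = d k x"
          using ex[OF step.hyps] by blast
        have hx: "d (k - 1) (h x) \<in> carrier (I k)"
          by (rule module_hom_closed[OF d' module_hom_closed[OF h x(1)]])
        have "d k (h' y) = d k (r \<odot>\<^bsub>I k\<^esub> x) \<ominus>\<^bsub>I (k + 1)\<^esub> d k (d (k - 1) (h x))"
          using x h'd g_eq module_hom_minus[OF I I d _ hx] r by simp
        also have "\<dots> = r \<odot>\<^bsub>I (k + 1)\<^esub> y"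
          using x r dd[OF module_hom_closed[OF h x(1)]] module_hom_smult[OF d r x(1)]
            module_hom_closed[OF d x(1)]
          by (simp add: a_minus_def)
        finally show ?thesis by simp
      qed
      then show ?case using h' by (intro bexI[of _ h']) (simp_all add: add.assoc)
    qed
  qed
qed

text \<open>
  On a cocycle \<open>x\<close> the contraction \<open>h\<close> gives \<open>r x = d (h x)\<close>. Since \<open>h\<close> is linear, \<open>h x\<close> is torsion
  whenever \<open>x\<close> is, so \<open>r x\<close> is a coboundary of the torsion subcomplex and not merely of the resolution.
\<close>

lemma local_cohomology_annihilated:
  assumes m: "ideal m R" and M: "module R M" and res: "injective_resolution R M I d e"
    and r: "r \<in> carrier R" and rM: "\<And>x. x \<in> carrier M \<Longrightarrow> r \<odot>\<^bsub>M\<^esub> x = \<zero>\<^bsub>M\<^esub>"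
    and X: "X \<in> carrier (local_cohomology R m I d k)"
  shows "r \<odot>\<^bsub>local_cohomology R m I d k\<^esub> X = \<zero>\<^bsub>local_cohomology R m I d k\<^esub>"
proof -
  let ?C = "\<lambda>j. torsion_part R m (I j)"
  let ?Z = "cocycles ?C d k" and ?B = "coboundaries ?C d k"
  note C = torsion_part_complex[OF m injective_resolution_complex[OF res]]
  note quot = cocycles_module[OF C, of k] coboundaries_submodule[OF C, of k]
  have I: "module R (I j)" for j
    using injective_resolution_complex[OF res] by (simp add: cochain_complex_def)
  obtain h where h: "h \<in> module_hom R (I k) (I (k - 1))"
    and hd: "\<And>x. x \<in> a_kernel (I k) (I (k + 1)) (d k) \<Longrightarrow> r \<odot>\<^bsub>I k\<^esub> x = d (k - 1) (h x)"
    using annihilated_resolution_contraction[OF M res r rM, of k] by blast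
  from X obtain x where x: "x \<in> carrier ?Z" "X = ?B +>\<^bsub>?Z\<^esub> x"
    by (auto simp: local_cohomology_def cohomology_def quot_module_carrier)
  have "r \<odot>\<^bsub>?Z\<^esub> x = d (k - 1) (h x)"
    using hd[of x] x(1) by (simp add: cocycles_def torsion_part_def a_kernel_iff)
  moreover have "h x \<in> carrier (?C (k - 1))"
    using module_hom_closed[OF torsion_part_map[OF m I I h]] x(1)
    by (simp add: cocycles_def a_kernel_iff)
  ultimately have "r \<odot>\<^bsub>?Z\<^esub> x \<in> ?B" by (simp add: coboundaries_def)
  then show ?thesis
    using x(2) quot_module_smult[OF quot r x(1)] coset_of_member[OF quot]
    by (simp add: local_cohomology_def cohomology_def)
qed

section \<open>Artinian inverse limits\<close>

text \<open>
  The kernels of the projections to the components form a descending chain with intersection zero.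
  In an Artinian limit the chain stabilizes, necessarily at zero, so the limit embeds into one component.
\<close>

lemma artinian_inverse_limit_component:
  assumes H: "\<And>n. module R (H n)" and t: "\<And>n. t n \<in> module_hom R (H (Suc n)) (H n)"
    and art: "artinian_module R (inverse_limit H t)"
  obtains n where "\<And>x. x \<in> carrier (inverse_limit H t) \<Longrightarrow> x n = \<zero>\<^bsub>H n\<^esub> \<Longrightarrow> x = \<zero>\<^bsub>inverse_limit H t\<^esub>"
proof -
  let ?F = "inverse_limit H t"
  let ?K = "\<lambda>n. {x \<in> carrier ?F. x n = \<zero>\<^bsub>H n\<^esub>}"
  interpret H: module R "H n" for n by (rule H)
  have F: "module R ?F" by (rule inverse_limit_is_module; rule H t)
  interpret F: module R ?F by (rule F)
  have ops: "\<zero>\<^bsub>?F\<^esub> n = \<zero>\<^bsub>H n\<^esub>" "(x \<oplus>\<^bsub>?F\<^esub> y) n = x n \<oplus>\<^bsub>H n\<^esub> y n" "(r \<odot>\<^bsub>?F\<^esub> x) n = r \<odot>\<^bsub>H n\<^esub> x n" for n x y r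
    by (auto simp: inverse_limit_def)
  have "submodule (?K n) R ?F" for n
  proof (rule submodule_criterion[OF F])
    show "\<zero>\<^bsub>?F\<^esub> \<in> ?K n" using F.M.zero_closed by (simp add: ops)
    show "x \<oplus>\<^bsub>?F\<^esub> y \<in> ?K n" if "x \<in> ?K n" "y \<in> ?K n" for x y
      using that F.M.add.m_closed[of x y] by (simp add: ops)
    show "r \<odot>\<^bsub>?F\<^esub> x \<in> ?K n" if "r \<in> carrier R" "x \<in> ?K n" for r x
      using that F.smult_closed[of r x] by (simp add: ops)
  qed blast
  moreover have dec: "?K (Suc n) \<subseteq> ?K n" for n
  proof
    fix x assume x: "x \<in> ?K (Suc n)"
    then have "\<forall>j. x j \<in> carrier (H j) \<and> t j (x (Suc j)) = x j" "x (Suc n) = \<zero>\<^bsub>H (Suc n)\<^esub>"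
      by (auto simp only: inverse_limit_def partial_object.simps)
    then have "t n (x (Suc n)) = x n" "x (Suc n) = \<zero>\<^bsub>H (Suc n)\<^esub>" by blast+
    then show "x \<in> ?K n" using x module_hom_zero[OF H H t, of n] by simp
  qed
  ultimately obtain n where n: "\<And>j. j \<ge> n \<Longrightarrow> ?K j = ?K n"
    using art[unfolded artinian_module_def, THEN spec[of _ ?K]] by auto
  have zero: "x j = \<zero>\<^bsub>H j\<^esub>" if "x \<in> ?K n" for x j
  proof -
    have "x \<in> ?K (max n j)" using n[of "max n j"] that by simp
    moreover have "?K (max n j) \<subseteq> ?K j"
      by (rule lift_Suc_antimono_le[of ?K, OF dec]) simp
    ultimately show ?thesis by blast
  qed
  show thesis
  proof (rule that[of n])
    fix x assume "x \<in> carrier ?F" "x n = \<zero>\<^bsub>H n\<^esub>"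
    then have "x = (\<lambda>j. \<zero>\<^bsub>H j\<^esub>)" using zero[of x] by (intro ext) simp
    then show "x = \<zero>\<^bsub>?F\<^esub>" by (simp add: inverse_limit_def)
  qed
qed

lemma formal_local_cohomology_tower:
  assumes m: "ideal m R" and res: "adic_resolutions R a M I d e \<phi>"
  shows "module R (local_cohomology R m (I n) (d n) i)"
    and "local_cohomology_map R m (I n) (d n) (\<phi> n) i \<in>
      module_hom R (local_cohomology R m (I (Suc n)) (d (Suc n)) i) (local_cohomology R m (I n) (d n) i)"
proof -
  have res': "injective_resolution R (adic_quotient R a M n) (I n) (d n) (e n)"
    and phi: "\<phi> n k \<in> module_hom R (I (Suc n) k) (I n k)"
    and phid: "x \<in> carrier (I (Suc n) k) \<Longrightarrow> \<phi> n (k + 1) (d (Suc n) k x) = d n k (\<phi> n k x)" for n k x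
    using res by (auto simp: adic_resolutions_def)
  have cpx: "cochain_complex R (I n) (d n)" for n
    by (rule injective_resolution_complex[OF res'])
  then have mod: "module R (I n k)" for n k by (simp add: cochain_complex_def)
  show "module R (local_cohomology R m (I n) (d n) i)"
    unfolding local_cohomology_def by (rule cohomology_is_module[OF torsion_part_complex[OF m cpx]])
  show "local_cohomology_map R m (I n) (d n) (\<phi> n) i \<in>
      module_hom R (local_cohomology R m (I (Suc n)) (d (Suc n)) i) (local_cohomology R m (I n) (d n) i)"
    unfolding local_cohomology_def local_cohomology_map_def
  proof (rule cohomology_map_in_module_hom[OF torsion_part_complex[OF m cpx] torsion_part_complex[OF m cpx]])
    show "\<phi> n k \<in> module_hom R (torsion_part R m (I (Suc n) k)) (torsion_part R m (I n k))" for k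
      by (rule torsion_part_map[OF m mod mod phi])
  qed (simp add: torsion_part_def phid)
qed

lemma formal_local_cohomology_is_module:
  assumes "ideal m R" "adic_resolutions R a M I d e \<phi>"
  shows "module R (formal_local_cohomology R m I d \<phi> i)"
  unfolding formal_local_cohomology_def
  by (rule inverse_limit_is_module; rule formal_local_cohomology_tower[OF assms])

text \<open>
  An Artinian formal local cohomology module embeds into a single \<open>H\<^sup>i\<^sub>m(M/a\<^sup>nM)\<close>, and \<open>a\<^sup>n\<close>
  annihilates \<open>M/a\<^sup>nM\<close>, hence its local cohomology, hence every submodule of that.
\<close>

lemma formal_local_cohomology_annihilated:
  assumes R: "cring R" and m: "ideal m R" and a: "ideal a R" and M: "module R M"
    and res: "adic_resolutions R a M I d e \<phi>"
    and art: "artinian_module R (formal_local_cohomology R m I d \<phi> i)"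
  obtains n where "\<And>r x. r \<in> ideal_power R a n \<Longrightarrow> x \<in> carrier (formal_local_cohomology R m I d \<phi> i) \<Longrightarrow>
      r \<odot>\<^bsub>formal_local_cohomology R m I d \<phi> i\<^esub> x = \<zero>\<^bsub>formal_local_cohomology R m I d \<phi> i\<^esub>"
proof -
  let ?F = "formal_local_cohomology R m I d \<phi> i"
  let ?H = "\<lambda>n. local_cohomology R m (I n) (d n) i"
  let ?t = "\<lambda>n. local_cohomology_map R m (I n) (d n) (\<phi> n) i"
  have F_def: "?F = inverse_limit ?H ?t" by (simp add: formal_local_cohomology_def)
  interpret F: module R ?F by (rule formal_local_cohomology_is_module[OF m res])
  have res': "injective_resolution R (adic_quotient R a M n) (I n) (d n) (e n)" for n
    using res by (simp add: adic_resolutions_def)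
  obtain n where n: "\<And>x. x \<in> carrier ?F \<Longrightarrow> x n = \<zero>\<^bsub>?H n\<^esub> \<Longrightarrow> x = \<zero>\<^bsub>?F\<^esub>"
    using artinian_inverse_limit_component[of R ?H ?t, OF formal_local_cohomology_tower[OF m res] art[unfolded F_def]]
    unfolding F_def by blast
  show thesis
  proof (rule that)
    fix r x assume r: "r \<in> ideal_power R a n" and x: "x \<in> carrier ?F"
    have rR: "r \<in> carrier R" using ideal.Icarr[OF ideal_power_is_ideal[OF R a] r] .
    have "x n \<in> carrier (?H n)" using x by (simp add: F_def inverse_limit_def)
    then have "r \<odot>\<^bsub>?H n\<^esub> x n = \<zero>\<^bsub>?H n\<^esub>"
      using local_cohomology_annihilated[OF m adic_quotient_is_module[OF R a M] res' rR]
        adic_quotient_annihilated[OF R a M r] by blast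
    then have "(r \<odot>\<^bsub>?F\<^esub> x) n = \<zero>\<^bsub>?H n\<^esub>" by (simp add: F_def inverse_limit_def)
    then show "r \<odot>\<^bsub>?F\<^esub> x = \<zero>\<^bsub>?F\<^esub>" using n rR x by simp
  qed
qed

section \<open>Colocalization and cosupport\<close>

lemma dual_annihilated:
  assumes N: "module R N" and E: "module R E" and u: "u \<in> carrier R"
    and uN: "\<And>x. x \<in> carrier N \<Longrightarrow> u \<odot>\<^bsub>N\<^esub> x = \<zero>\<^bsub>N\<^esub>"
    and f: "f \<in> carrier (dual R E N)"
  shows "u \<odot>\<^bsub>dual R E N\<^esub> f = \<zero>\<^bsub>dual R E N\<^esub>"
proof -
  have f: "f \<in> module_hom R N E" using f by (simp add: dual_def hom_module_def)
  have "u \<odot>\<^bsub>E\<^esub> f x = \<zero>\<^bsub>E\<^esub>" if "x \<in> carrier N" for x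
    using module_hom_smult[OF f u that] uN[OF that] module_hom_zero[OF N E f] by simp
  then show ?thesis by (auto simp: dual_def hom_module_def)
qed

text \<open>
  A scalar outside \<open>p\<close> that annihilates \<open>M\<close> identifies any two fractions, so each fraction is the
  class of all pairs.
\<close>

lemma fraction_of_annihilated:
  assumes M: "module R M" and u: "u \<in> carrier R - p"
    and uM: "\<And>x. x \<in> carrier M \<Longrightarrow> u \<odot>\<^bsub>M\<^esub> x = \<zero>\<^bsub>M\<^esub>"
    and x: "x \<in> carrier M" and s: "s \<in> carrier R"
  shows "fraction R p M x s = carrier M \<times> (carrier R - p)"
proof -
  interpret module R M by (rule M)
  show ?thesis using u uM x s by (auto simp: fraction_def intro!: bexI[of _ u])
qed

text \<open>
  The localization is zero. It is described by its only element, together with the values of the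
  operations there; this is all that is needed to compute the homomorphisms out of it.
\<close>

lemma local_module_of_annihilated:
  assumes p: "primeideal p R" and D: "module R D"
    and u: "u \<in> carrier R - p" and uD: "\<And>x. x \<in> carrier D \<Longrightarrow> u \<odot>\<^bsub>D\<^esub> x = \<zero>\<^bsub>D\<^esub>"
  obtains z where "carrier (local_module R p D) = {z}" "z \<oplus>\<^bsub>local_module R p D\<^esub> z = z"
    "\<And>A. A \<in> carrier (localization R p) \<Longrightarrow> A \<odot>\<^bsub>local_module R p D\<^esub> z = z"
proof
  let ?T = "carrier D \<times> (carrier R - p)"
  interpret p: primeideal p R by (rule p)
  interpret D: module R D by (rule D)
  have one: "\<one>\<^bsub>R\<^esub> \<in> carrier R - p"
    using p.I_notcarr p.one_imp_carrier by auto
  have frac: "fraction R p D x s = ?T" if "x \<in> carrier D" "s \<in> carrier R" for x s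
    by (rule fraction_of_annihilated[OF D u uD that])
  have T: "(\<zero>\<^bsub>D\<^esub>, \<one>\<^bsub>R\<^esub>) \<in> ?T" using one by auto
  show "carrier (local_module R p D) = {?T}"
    using frac T by (fastforce simp: local_module_def)
  show "?T \<oplus>\<^bsub>local_module R p D\<^esub> ?T = ?T"
  proof -
    have inner: "(\<Union>(y, t)\<in>?T. fraction R p D (t \<odot>\<^bsub>D\<^esub> x \<oplus>\<^bsub>D\<^esub> s \<odot>\<^bsub>D\<^esub> y) (s \<otimes>\<^bsub>R\<^esub> t)) = ?T"
      if "x \<in> carrier D" "s \<in> carrier R" for x s
      by (rule UN_constant[OF _ T]) (clarsimp simp: frac that)
    have "(\<Union>(x, s)\<in>?T. \<Union>(y, t)\<in>?T.
        fraction R p D (t \<odot>\<^bsub>D\<^esub> x \<oplus>\<^bsub>D\<^esub> s \<odot>\<^bsub>D\<^esub> y) (s \<otimes>\<^bsub>R\<^esub> t)) = ?T"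
      by (rule UN_constant[OF _ T]) (clarsimp simp: inner)
    then show ?thesis by (simp add: local_module_def)
  qed
  show "A \<odot>\<^bsub>local_module R p D\<^esub> ?T = ?T" if A: "A \<in> carrier (localization R p)" for A
  proof -
    from A obtain r s where rs: "r \<in> carrier R" "s \<in> carrier R - p"
      and A_eq: "A = fraction R p (regular_module R) r s"
      by (auto simp: localization_def local_module_def regular_module_def)
    have rsA: "(r, s) \<in> A" and A_sub: "A \<subseteq> carrier R \<times> (carrier R - p)"
      using rs one by (auto simp: A_eq fraction_def regular_module_def intro!: bexI[of _ "\<one>\<^bsub>R\<^esub>"])
    have inner: "(\<Union>(x, t)\<in>?T. fraction R p D (r \<odot>\<^bsub>D\<^esub> x) (s \<otimes>\<^bsub>R\<^esub> t)) = ?T"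
      if "r \<in> carrier R" "s \<in> carrier R" for r s
      by (rule UN_constant[OF _ T]) (clarsimp simp: frac that)
    have "(\<Union>(r, s)\<in>A. \<Union>(x, t)\<in>?T. fraction R p D (r \<odot>\<^bsub>D\<^esub> x) (s \<otimes>\<^bsub>R\<^esub> t)) = ?T"
    proof (rule UN_constant[OF _ rsA])
      fix z assume "z \<in> A"
      then have "z \<in> carrier R \<times> (carrier R - p)" using A_sub by (rule subsetD[rotated])
      then show "(case z of (r, s) \<Rightarrow> \<Union>(x, t)\<in>?T. fraction R p D (r \<odot>\<^bsub>D\<^esub> x) (s \<otimes>\<^bsub>R\<^esub> t)) = ?T"
        by (clarsimp simp: inner)
    qed
    then show ?thesis by (simp add: local_module_def)
  qed
qed

lemma hom_module_from_singleton:
  assumes M: "carrier M = {z}" "z \<oplus>\<^bsub>M\<^esub> z = z" "\<And>r. r \<in> carrier R \<Longrightarrow> r \<odot>\<^bsub>M\<^esub> z = z"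
    and N: "module R N"
  shows "carrier (hom_module R M N) = {\<zero>\<^bsub>hom_module R M N\<^esub>}"
proof -
  interpret N: module R N by (rule N)
  have zero: "f z = \<zero>\<^bsub>N\<^esub>" if f: "f \<in> module_hom R M N" for f
  proof -
    have "f z \<in> carrier N" "f z = f z \<oplus>\<^bsub>N\<^esub> f z"
      using module_hom_closed[OF f, of z] module_hom_add[OF f, of z z] by (simp_all add: M)
    then show ?thesis by (metis N.M.add.r_cancel_one')
  qed
  have "f = \<zero>\<^bsub>hom_module R M N\<^esub>" if "f \<in> carrier (hom_module R M N)" for f
  proof (rule extensionalityI)
    show "f \<in> extensional (carrier M)" "\<zero>\<^bsub>hom_module R M N\<^esub> \<in> extensional (carrier M)"
      using that by (auto simp: hom_module_def)
    show "f x = \<zero>\<^bsub>hom_module R M N\<^esub> x" if "x \<in> carrier M" for x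
      using that zero \<open>f \<in> carrier (hom_module R M N)\<close> by (simp add: hom_module_def M(1))
  qed
  moreover have "\<zero>\<^bsub>hom_module R M N\<^esub> \<in> carrier (hom_module R M N)"
    using M by (simp add: hom_module_def module_hom_def)
  ultimately show ?thesis by blast
qed

text \<open>
  Annihilators pass to the dual, and a scalar outside \<open>p\<close> becomes a unit in the localization at \<open>p\<close>;
  so the localized dual is zero, and with it the module of homomorphisms out of it.
\<close>

lemma colocalization_of_annihilated:
  assumes p: "primeideal p R" and N: "module R N" and E: "module R E"
    and Ep: "module (localization R p) Ep"
    and u: "u \<in> carrier R - p" and uN: "\<And>x. x \<in> carrier N \<Longrightarrow> u \<odot>\<^bsub>N\<^esub> x = \<zero>\<^bsub>N\<^esub>"
  shows "carrier (colocalization R E Ep p N) = {\<zero>\<^bsub>colocalization R E Ep p N\<^esub>}"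
proof -
  have D: "module R (dual R E N)" unfolding dual_def by (rule hom_module_is_module[OF N E])
  have uD: "u \<odot>\<^bsub>dual R E N\<^esub> f = \<zero>\<^bsub>dual R E N\<^esub>" if "f \<in> carrier (dual R E N)" for f
    by (rule dual_annihilated[OF N E _ uN that]) (use u in auto)
  obtain z where z: "carrier (local_module R p (dual R E N)) = {z}"
      "z \<oplus>\<^bsub>local_module R p (dual R E N)\<^esub> z = z"
      "\<And>A. A \<in> carrier (localization R p) \<Longrightarrow> A \<odot>\<^bsub>local_module R p (dual R E N)\<^esub> z = z"
    using local_module_of_annihilated[OF p D u uD] by blast
  show ?thesis
    unfolding colocalization_def dual_def[of "localization R p"]
    by (rule hom_module_from_singleton[OF z Ep])
qed

lemma prime_contains_root:
  assumes p: "primeideal p R" and s: "s \<in> carrier R"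
  shows "s [^]\<^bsub>R\<^esub> (n :: nat) \<in> p \<Longrightarrow> s \<in> p"
proof (induction n)
  interpret primeideal p R by (rule p)
  case 0
  then show ?case using one_imp_carrier I_notcarr by auto
next
  interpret primeideal p R by (rule p)
  case (Suc n)
  then show ?case using I_prime[of "s [^]\<^bsub>R\<^esub> n" s] s by auto
qed

theorem corollary3p5:
  fixes R :: "('a, 'r) ring_scheme"
    and m a :: "'a set"
    and M :: "('a, 'm) module"
    and I :: "nat \<Rightarrow> int \<Rightarrow> ('a, 'e) module"
    and d \<phi> :: "nat \<Rightarrow> int \<Rightarrow> 'e \<Rightarrow> 'e"
    and e :: "nat \<Rightarrow> 'm set \<Rightarrow> 'e"
    and E :: "('a, 'f) module"
    and EL :: "'a set \<Rightarrow> (('a \<times> 'a) set, 'g) module"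
    and i :: int
  assumes "noetherian_ring R" and "local_ring R m"
    and "ideal a R"
    and "module R M" and "finitely_generated R M"
    and "adic_resolutions R a M I d e \<phi>"
    and "is_E R E" and "\<And>p. p \<in> Spec R \<Longrightarrow> is_E (localization R p) (EL p)"
    and "artinian_module R (formal_local_cohomology R m I d \<phi> i)"
  shows "CoSupp R E EL (formal_local_cohomology R m I d \<phi> i) \<subseteq> V R a"
proof
  let ?F = "formal_local_cohomology R m I d \<phi> i"
  fix p assume "p \<in> CoSupp R E EL ?F"
  then have p: "p \<in> Spec R"
    and ne: "carrier (colocalization R E (EL p) p ?F) \<noteq> {\<zero>\<^bsub>colocalization R E (EL p) p ?F\<^esub>}"
    by (auto simp: CoSupp_def)
  have R: "cring R" and "maximalideal m R"
    using assms(2) by (auto simp: local_ring_def)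
  then have m: "ideal m R" by (simp add: maximalideal_def)
  interpret R: cring R by (rule R)
  have prime: "primeideal p R" using p by (simp add: Spec_def)
  obtain n where n: "\<And>r x. r \<in> ideal_power R a n \<Longrightarrow> x \<in> carrier ?F \<Longrightarrow> r \<odot>\<^bsub>?F\<^esub> x = \<zero>\<^bsub>?F\<^esub>"
    using formal_local_cohomology_annihilated[OF R m assms(3,4,6,9)] by blast
  have F: "module R ?F" by (rule formal_local_cohomology_is_module[OF m assms(6)])
  have E: "module R E" and Ep: "module (localization R p) (EL p)"
    using assms(7) assms(8)[OF p] by (simp_all add: is_E_def injective_hull_def injective_module_def)
  have "a \<subseteq> p"
  proof
    fix s assume s: "s \<in> a"
    then have sR: "s \<in> carrier R" using ideal.Icarr[OF assms(3)] by blast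
    have "s [^]\<^bsub>R\<^esub> n \<in> p"
    proof (rule ccontr)
      assume "s [^]\<^bsub>R\<^esub> n \<notin> p"
      then show False
        using colocalization_of_annihilated[OF prime F E Ep, of "s [^]\<^bsub>R\<^esub> n"]
          n[OF power_in_ideal_power[OF R assms(3) s]] sR ne by simp
    qed
    then show "s \<in> p"
      by (rule prime_contains_root[OF prime sR])
  qed
  then show "p \<in> V R a" using p by (simp add: V_def)
qed

end
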